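(* Let $\lambda\in\mathbb C\setminus\{0\}$ and $\nu\in\mathbb C$. The Voros coefficient of the quantum Weber curve $$\left\{\hbar^2\frac{d^2}{dx^2}-\left(\frac{x^2}{4}-\lambda+\frac{\hbar\nu}{2}\right)\right\}\psi=0$$ is given, as a formal power series in $\hbar$, by $$V(\lambda,\nu;\hbar)=\sum_{m=1}^\infty\frac{B_{m+1}\big((\nu+1)/2\big)}{m(m+1)}\left(\frac{\hbar}{\lambda}\right)^m,$$ where $B_m(X)$ are the Bernoulli polynomials defined by $\frac{we^{Xw}}{e^w-1}=\sum_{m=0}^\infty B_m(X)\frac{w^m}{m!}$.
   Context: Let $S(x,\lambda,\nu;\hbar)=\sum_{m\ge-1}\hbar^mS_m(x,\lambda,\nu)$ be the formal solution of the Riccati equation $\hbar^2\left(\frac{dS}{dx}+S^2\right)=\frac{x^2}{4}-\lambda+\frac{\hbar\nu}{2}$ with $S_{-1}=\sqrt{x^2/4-\lambda}$; once the branch of $S_{-1}$ is chosen, all $S_m$ are determined recursively. Use the parametrization $x(z)=\sqrt\lambda\,(z+1/z)$, $z\in\mathbb P^1$, of the two-sheeted Riemann surface of $S_{-1}$, with the branch $S_{-1}(x(z))=\frac{\sqrt\lambda}{2}(z-1/z)$ (so $S_{-1}\sim x/2$ as $z\to\infty$ and $S_{-1}\sim-x/2$ as $z\to0$). The Voros coefficient is $$V(\lambda,\nu;\hbar):=\sum_{m\ge1}\hbar^m\int_\gamma S_m(x,\lambda,\nu)\,dx=\sum_{m\ge1}\hbar^m\int_{z=0}^{z=\infty}S_m(x(z),\lambda,\nu)\,\frac{dx}{dz}\,dz,$$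 where $\gamma$ is the image under $x(z)$ of a path in the $z$-plane from $0$ to $\infty$ avoiding $z=\pm1$ (for $m\ge1$ the integrand is a rational differential in $z$ with poles only at $z=\pm1$, with zero residues there). *)

theory Defs
  imports "HOL-Complex_Analysis.Complex_Analysis"
begin

text \<open>
  Throughout, \<open>s\<close> is a square root of \<open>lam\<close>, the parameter \<open>\<lambda>\<close>. Functions on the two-sheeted Riemann surface of
  \<open>S\<^sub>-\<^sub>1 = sqrt (x^2/4 - lam)\<close> are represented as functions of the uniformizing parameter \<open>z\<close>;
  formal (Laurent) series in \<open>\<hbar>\<close> are elements of \<open>complex fls\<close> with \<open>\<hbar>\<close> rendered as
  \<^const>\<open>fls_X\<close>.
\<close>

definition weber_x :: "complex \<Rightarrow> complex \<Rightarrow> complex" where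
  "weber_x s z = s * (z + 1 / z)"

text \<open>
  The derivation \<open>d/dx = (dx/dz)\<^bsup>-1\<^esup> d/dz\<close>, acting coefficientwise on a \<open>z\<close>-dependent Laurent
  series in \<open>\<hbar>\<close>. (\<^const>\<open>Abs_fls\<close> is meaningful when the coefficients vanish below a fixed
  order, as is the case for the series considered below.)
\<close>

definition weber_ddx :: "complex \<Rightarrow> (complex \<Rightarrow> complex fls) \<Rightarrow> complex \<Rightarrow> complex fls" where
  "weber_ddx s S z =
     Abs_fls (\<lambda>m. deriv (\<lambda>w. fls_nth (S w) m) z / deriv (weber_x s) z)"

text \<open>
  \<open>S z\<close> is the series \<open>S(x(z), \<lambda>, \<nu>; \<hbar>)\<close>. The points \<open>z = \<plusminus>1\<close> lie over the turning points and
  \<open>z = 0\<close> over \<open>x = \<infinity>\<close>.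
\<close>

definition weber_riccati_solution ::
    "complex \<Rightarrow> complex \<Rightarrow> complex \<Rightarrow> (complex \<Rightarrow> complex fls) \<Rightarrow> bool" where
  "weber_riccati_solution lam s \<nu> S \<longleftrightarrow>
     (\<forall>m. (\<lambda>z. fls_nth (S z) m) holomorphic_on - {0, 1, -1}) \<and>
     (\<forall>z \<in> - {0, 1, -1}.
        (\<forall>m < -1. fls_nth (S z) m = 0) \<and>
        fls_nth (S z) (-1) = s / 2 * (z - 1 / z) \<and>
        fls_X ^ 2 * (weber_ddx s S z + S z ^ 2) =
          fls_const (weber_x s z ^ 2 / 4 - lam) + fls_const (\<nu> / 2) * fls_X)"

text \<open>
  Paths \<open>\<gamma>\<close> from \<open>0\<close> to \<open>\<infinity>\<close> in the \<open>z\<close>-plane avoiding \<open>\<plusminus>1\<close>, parametrized by \<open>{0..<1}\<close>.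
\<close>

definition path_zero_to_infinity :: "(real \<Rightarrow> complex) \<Rightarrow> bool" where
  "path_zero_to_infinity \<gamma> \<longleftrightarrow>
     \<gamma> 0 = 0 \<and>
     (\<forall>u \<in> {0<..<1}. valid_path (subpath 0 u \<gamma>)) \<and>
     filterlim \<gamma> at_infinity (at_left 1) \<and>
     (\<forall>t \<in> {0..<1}. \<gamma> t \<notin> {1, -1})"

definition integral_zero_to_infinity :: "(real \<Rightarrow> complex) \<Rightarrow> (complex \<Rightarrow> complex) \<Rightarrow> complex" where
  "integral_zero_to_infinity \<gamma> f =
     Lim (at_left 1) (\<lambda>u. contour_integral (subpath 0 u \<gamma>) f)"

text \<open>
  For \<open>m \<ge> 1\<close> the differential \<open>S\<^sub>m(x(z)) (dx/dz) dz\<close> is regular at \<open>z = 0\<close>;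
  \<^const>\<open>remove_sings\<close> assigns the correct value to the integrand at this point.
\<close>

definition weber_voros :: "complex \<Rightarrow> (real \<Rightarrow> complex) \<Rightarrow> (complex \<Rightarrow> complex fls) \<Rightarrow> complex fps" where
  "weber_voros s \<gamma> S =
     Abs_fps (\<lambda>m. if m = 0 then 0 else
       integral_zero_to_infinity \<gamma>
         (remove_sings (\<lambda>z. fls_nth (S z) (int m) * deriv (weber_x s) z)))"

definition bernoulli_polynomial :: "nat \<Rightarrow> complex \<Rightarrow> complex" where
  "bernoulli_polynomial m X =
     fact m * fps_nth (fps_X * fps_exp X / (fps_exp 1 - 1)) m"


text \<open>Existence of the formal solution, by the usual recursion (index shifted by one).\<close>

fun weber_coeff :: "complex \<Rightarrow> complex \<Rightarrow> nat \<Rightarrow> complex \<Rightarrow> complex" where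
  "weber_coeff s \<nu> 0 = (\<lambda>z. s / 2 * (z - 1 / z))"
| "weber_coeff s \<nu> (Suc n) = (\<lambda>z.
     ((if n = 0 then \<nu> / 2 else 0) - deriv (weber_coeff s \<nu> n) z / deriv (weber_x s) z
       - (\<Sum>i = 1..n. weber_coeff s \<nu> i z * weber_coeff s \<nu> (Suc n - i) z))
     / (s * (z - 1 / z)))"

lemma deriv_weber_x: "z \<noteq> 0 \<Longrightarrow> deriv (weber_x s) z = s * (1 - 1 / z ^ 2)"
  unfolding weber_x_def [abs_def]
  by (rule DERIV_imp_deriv) (auto intro!: derivative_eq_intros simp: field_simps power2_eq_square)

lemma deriv_weber_x_nz:
  assumes "s \<noteq> 0" "z \<notin> {0, 1, -1}"
  shows "deriv (weber_x s) z \<noteq> 0"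
  using assms by (auto simp: deriv_weber_x power2_eq_1_iff)

lemma weber_coeff_holomorphic:
  assumes "s \<noteq> 0"
  shows "weber_coeff s \<nu> n holomorphic_on - {0, 1, -1}"
proof (induction n rule: less_induct)
  case (less n)
  have op: "open (- {0, 1, -1 :: complex})"
    by (intro open_Compl finite_imp_closed) auto
  have x: "weber_x s holomorphic_on - {0, 1, -1}"
    unfolding weber_x_def [abs_def] by (intro holomorphic_intros) auto
  have nz: "s * (z - 1 / z) \<noteq> 0" if "z \<in> - {0, 1, -1}" for z
    using that assms by (auto simp: field_simps power2_eq_1_iff simp flip: power2_eq_square)
  show ?case
  proof (cases n)
    case 0
    then show ?thesis by (auto intro!: holomorphic_intros)
  next
    case (Suc k)
    have "weber_coeff s \<nu> k holomorphic_on - {0, 1, -1}"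
      using less Suc by auto
    moreover have "weber_coeff s \<nu> i holomorphic_on - {0, 1, -1}"
      "weber_coeff s \<nu> (Suc k - i) holomorphic_on - {0, 1, -1}" if "i \<in> {1..k}" for i
      using less Suc that by auto
    ultimately show ?thesis
      unfolding Suc weber_coeff.simps
      by (intro holomorphic_intros x op) (use nz deriv_weber_x_nz assms in auto)
  qed
qed

lemma weber_riccati_solution_exists:
  assumes "lam \<noteq> 0" "s ^ 2 = lam"
  shows "\<exists>S. weber_riccati_solution lam s \<nu> S"
proof -
  have s: "s \<noteq> 0" using assms by auto
  define S where "S = (\<lambda>z. fls_shift 1 (fps_to_fls (Abs_fps (\<lambda>n. weber_coeff s \<nu> n z))))"
  have nth: "fls_nth (S z) m = (if m < -1 then 0 else weber_coeff s \<nu> (nat (m + 1)) z)" for z m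
    by (auto simp: S_def)
  have ddx: "weber_ddx s S z = fls_shift 1 (fps_to_fls
      (Abs_fps (\<lambda>n. deriv (weber_coeff s \<nu> n) z / deriv (weber_x s) z)))" (is "_ = ?R") for z
  proof -
    have "fls_nth ?R m = deriv (\<lambda>w. fls_nth (S w) m) z / deriv (weber_x s) z" for m
      unfolding nth by auto
    then have "(\<lambda>m. deriv (\<lambda>w. fls_nth (S w) m) z / deriv (weber_x s) z) = fls_nth ?R"
      by auto
    then show ?thesis
      unfolding weber_ddx_def by (simp add: fls_nth_inverse)
  qed
  have "fls_X ^ 2 * (weber_ddx s S z + S z ^ 2) =
          fls_const (weber_x s z ^ 2 / 4 - lam) + fls_const (\<nu> / 2) * fls_X"
    if z: "z \<in> - {0, 1, -1}" for z
  proof -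
    define A where "A = Abs_fps (\<lambda>n. weber_coeff s \<nu> n z)"
    define A' where "A' = Abs_fps (\<lambda>n. deriv (weber_coeff s \<nu> n) z / deriv (weber_x s) z)"
    have dS: "weber_ddx s S z = fls_shift 1 (fps_to_fls A')"
      unfolding ddx A'_def ..
    have Sz: "S z = fls_shift 1 (fps_to_fls A)"
      unfolding S_def A_def ..
    have nz: "s * (z - 1 / z) \<noteq> 0"
      using z s by (auto simp: field_simps power2_eq_1_iff simp flip: power2_eq_square)
    have "fps_nth (fps_X * A' + A * A) n =
        fps_nth (fps_const (weber_x s z ^ 2 / 4 - lam) + fps_const (\<nu> / 2) * fps_X) n" for n
    proof (cases n)
      case 0
      then show ?thesis
        using z assms(2)
        by (simp add: A_def weber_x_def field_simps power2_eq_square)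
    next
      case (Suc k)
      have "fps_nth (A * A) (Suc k) = (\<Sum>i = 0..Suc k. weber_coeff s \<nu> i z * weber_coeff s \<nu> (Suc k - i) z)"
        by (simp add: fps_mult_nth A_def)
      also have "\<dots> = 2 * weber_coeff s \<nu> 0 z * weber_coeff s \<nu> (Suc k) z +
          (\<Sum>i = 1..k. weber_coeff s \<nu> i z * weber_coeff s \<nu> (Suc k - i) z)"
        by (subst sum.atLeast_Suc_atMost) (auto simp del: weber_coeff.simps)
      also have "2 * weber_coeff s \<nu> 0 z * weber_coeff s \<nu> (Suc k) z =
         (if k = 0 then \<nu> / 2 else 0) - deriv (weber_coeff s \<nu> k) z / deriv (weber_x s) z
       - (\<Sum>i = 1..k. weber_coeff s \<nu> i z * weber_coeff s \<nu> (Suc k - i) z)"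
        using nz by simp
      finally show ?thesis
        using Suc by (simp add: A'_def)
    qed
    then have eq: "fps_X * A' + A * A = fps_const (weber_x s z ^ 2 / 4 - lam) + fps_const (\<nu> / 2) * fps_X"
      by (simp add: fps_eq_iff)
    have "fls_X ^ 2 * (weber_ddx s S z + S z ^ 2) = fps_to_fls (fps_X * A' + A * A)"
      unfolding dS Sz
      by (simp add: fls_plus_const fls_times_fps_to_fls fps_to_fls_plus power2_eq_square
          algebra_simps fls_X_times_conv_shift fls_shifted_times_simps)
    then show ?thesis
      by (simp add: eq fls_times_fps_to_fls)
  qed
  moreover have "(\<lambda>z. fls_nth (S z) m) holomorphic_on - {0, 1, -1}" for m
    unfolding nth using weber_coeff_holomorphic [OF s] by (cases "m < -1") simp_all
  ultimately have "weber_riccati_solution lam s \<nu> S"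
    unfolding weber_riccati_solution_def by (auto simp: nth)
  then show ?thesis by blast
qed

end

theory Submission
  imports Defs
begin

text \<open>
  Two properties determine the Voros coefficient: how it changes when \<open>\<nu>\<close> is shifted by \<open>2\<close>, and how
  it depends infinitesimally on \<open>\<nu>\<close>. Both are the defining properties of Bernoulli polynomials in
  \<open>w = (\<nu> + 1) / 2\<close>.

  Everything is reduced to polynomials by the coordinate \<open>y = 1 / (z^2 - 1)\<close>, which sends
  \<open>z = \<infinity>, 0, \<plusminus>1\<close> to \<open>y = 0, -1, \<infinity>\<close>. Put \<open>h = \<hbar> / \<lambda>\<close>. For \<open>m \<ge> 0\<close> the coefficient \<open>S\<^sub>m\<close> is
  \<open>\<lambda>\<^bsup>-m\<^esup> s\<^bsup>-1\<^esup> z y c\<^sub>m\<close> with \<open>c\<^sub>m\<close> a polynomial in \<open>y\<close> and \<open>w\<close> (\<open>riccati_solution_formula\<close>), and the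
  series \<open>c = c\<^sub>0 + c\<^sub>1 h + c\<^sub>2 h^2 + \<dots>\<close> solves
  \<open>c = w - y - 1 - h y (y + 1) (c^2 - (2 y + 1) c - 2 y (y + 1) dc/dy)\<close>.
  Hence \<open>c\<^sub>m = -2 y (y + 1) r\<^sub>m\<close> for \<open>m \<ge> 1\<close>, again with \<open>r\<^sub>m\<close> a polynomial, and the differential
  simplifies to \<open>S\<^sub>m dx = \<lambda>\<^bsup>-m\<^esup> r\<^sub>m dy\<close> (\<open>weber_integrand\<close>). So it has a primitive that is a polynomial in
  \<open>y\<close>, hence regular away from \<open>z = \<plusminus>1\<close>. The integral does not depend on the path, and the \<open>m\<close>-th Voros
  coefficient is \<open>\<lambda>\<^bsup>-m\<^esup> v\<^sub>m(w)\<close>, where the polynomial \<open>v\<^sub>m\<close> is the integral of \<open>r\<^sub>m\<close> from \<open>y = -1\<close> to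
  \<open>y = 0\<close> (\<open>weber_voros_coefficient\<close>).

  Shift. If \<open>\<psi>\<close> solves the Weber equation with parameter \<open>\<nu>\<close>, then \<open>(\<hbar> d/dx + x/2) \<psi>\<close> solves it with
  \<open>\<nu> + 2\<close>. For logarithmic derivatives this means \<open>S(\<nu> + 2) = S(\<nu>) + d/dx log (\<hbar> S + x/2)\<close>, and
  \<open>\<hbar> S + x/2 = s z A\<close> with \<open>A = 1 + h y c\<close>. In terms of \<open>r\<close> it says \<open>r(w + 1) - r(w) = (dA/dy) / A\<close>, so
  the shift of \<open>v\<close> is read off from \<open>A\<close> at the ends, where \<open>A = 1\<close> (at \<open>y = 0\<close>) and \<open>A = 1 - h w\<close>
  (at \<open>y = -1\<close>): \<open>v\<^sub>m(w + 1) - v\<^sub>m(w) = w^m / m\<close> (\<open>weber_v_shift\<close>).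

  Derivative. The equation involves \<open>\<lambda>\<close> and \<open>\<nu>\<close> only through \<open>\<lambda> - \<hbar> \<nu> / 2\<close>, so \<open>\<nu>\<close>-derivatives are
  \<open>\<lambda>\<close>-derivatives, and homogeneity turns the latter into Euler operators. The outcome is
  \<open>dr\<^bsub>m+1\<^esub>/dw = m r\<^sub>m - d/dy (y (y + 1) (2 y + 1) r\<^sub>m)\<close>, whose last term integrates to zero, and thus
  \<open>dv\<^bsub>m+1\<^esub>/dw = m v\<^sub>m\<close> (\<open>pderiv_weber_v\<close>).

  The polynomials \<open>B\<^bsub>m+1\<^esub>(w) / (m (m + 1))\<close> obey the same two laws. The difference of the two families is
  therefore periodic, hence constant, for every \<open>m\<close>; and the \<open>m\<close>-th difference is a multiple of the
  derivative of the next one, hence zero (\<open>weber_v_eq_bernoulli\<close>).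
\<close>

section \<open>Derivations on power series with polynomial coefficients\<close>

definition pderiv_fps :: "complex poly fps \<Rightarrow> complex poly fps" where
  "pderiv_fps F = Abs_fps (\<lambda>n. pderiv (fps_nth F n))"

definition fps_euler :: "'a::comm_ring_1 fps \<Rightarrow> 'a fps" where
  "fps_euler F = fps_X * fps_deriv F"

lemma pderiv_fps_nth [simp]: "fps_nth (pderiv_fps F) n = pderiv (fps_nth F n)"
  by (simp add: pderiv_fps_def)

lemma pderiv_fps_add: "pderiv_fps (F + G) = pderiv_fps F + pderiv_fps G"
  by (simp add: fps_eq_iff pderiv_add)

lemma pderiv_fps_diff: "pderiv_fps (F - G) = pderiv_fps F - pderiv_fps G"
  by (simp add: fps_eq_iff pderiv_diff)

lemma pderiv_sum: "pderiv (sum f I) = (\<Sum>i\<in>I. pderiv (f i))"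
  by (induction I rule: infinite_finite_induct) (auto simp: pderiv_add)

lemma pderiv_fps_mult: "pderiv_fps (F * G) = pderiv_fps F * G + F * pderiv_fps G"
  by (rule fps_ext)
    (simp add: fps_mult_nth pderiv_sum pderiv_mult flip: sum.distrib, simp add: mult.commute add.commute)

lemma pderiv_fps_const [simp]: "pderiv_fps (fps_const a) = fps_const (pderiv a)"
  by (simp add: fps_eq_iff)

lemma pderiv_fps_1 [simp]: "pderiv_fps 1 = 0"
  by (simp add: fps_eq_iff)

lemma pderiv_fps_numeral [simp]: "pderiv_fps (numeral k) = 0"
  unfolding fps_numeral_fps_const by (simp add: pderiv_eq_0_iff)

lemma pderiv_fps_X [simp]: "pderiv_fps fps_X = 0"
  by (simp add: fps_eq_iff fps_X_def)

lemma fps_euler_nth: "fps_nth (fps_euler F) n = of_nat n * fps_nth F n"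
  by (cases n) (auto simp: fps_euler_def)

lemma fps_euler_add: "fps_euler (F + G) = fps_euler F + fps_euler G"
  by (simp add: fps_euler_def algebra_simps)

lemma fps_euler_diff: "fps_euler (F - G) = fps_euler F - fps_euler G"
  by (simp add: fps_euler_def algebra_simps)

lemma fps_euler_mult: "fps_euler (F * G) = fps_euler F * G + F * fps_euler G"
  by (simp add: fps_euler_def algebra_simps)

lemma fps_euler_const [simp]: "fps_euler (fps_const a) = 0"
  by (simp add: fps_euler_def)

lemma fps_euler_1 [simp]: "fps_euler 1 = 0"
  by (simp add: fps_euler_def)

lemma fps_euler_numeral [simp]: "fps_euler (numeral k) = 0"
  unfolding fps_numeral_fps_const by simp

lemma fps_euler_X [simp]: "fps_euler fps_X = fps_X"
  by (simp add: fps_euler_def)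

lemma pderiv_fps_euler: "pderiv_fps (fps_euler F) = fps_euler (pderiv_fps F)"
  by (rule fps_ext) (simp add: fps_euler_nth pderiv_mult)

text \<open>
  The factor \<open>h\<close> (\<^const>\<open>fps_X\<close>) makes every coefficient depend on earlier ones only; a derivative in
  \<open>y\<close> does no harm because it does not lower the order in \<open>h\<close>.
\<close>

lemma linear_fps_ode_unique:
  assumes "D = fps_X * (P * D + Q * pderiv_fps D)"
  shows "D = 0"
proof -
  have "fps_nth D n = 0" for n
  proof (induction n rule: less_induct)
    case (less n)
    show ?case
    proof (cases n)
      case 0
      then show ?thesis by (subst assms) simp
    next
      case (Suc k)
      have "fps_nth D n = fps_nth (P * D + Q * pderiv_fps D) k"
        by (subst assms) (simp add: Suc)
      also have "\<dots> = 0"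
        using less Suc by (simp add: fps_mult_nth)
      finally show ?thesis .
    qed
  qed
  then show ?thesis by (simp add: fps_eq_iff)
qed

section \<open>The Riccati equation in the coordinate y\<close>

definition y_poly :: "complex poly" where "y_poly = [:0, 1:]"

lemma pderiv_y_poly [simp]: "pderiv y_poly = 1"
  by (simp add: y_poly_def pderiv_pCons)

definition fps_y :: "complex poly fps" where "fps_y = fps_const y_poly"

text \<open>
  The Riccati equation in the coordinate \<open>y = 1 / (z^2 - 1)\<close>, after splitting off the factors
  described at the top; \<^const>\<open>fps_X\<close> stands for \<open>\<hbar> / \<lambda>\<close> and \<open>w\<close> for \<open>(\<nu> + 1) / 2\<close>.
\<close>

definition weber_riccati_fps :: "complex \<Rightarrow> complex poly fps \<Rightarrow> bool" where
  "weber_riccati_fps w c \<longleftrightarrow>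
     c = fps_const [:w:] - fps_y - 1 - fps_X * (fps_y * (fps_y + 1)) *
       (c ^ 2 - (2 * fps_y + 1) * c - 2 * (fps_y * (fps_y + 1)) * pderiv_fps c)"

lemma pderiv_fps_y [simp]: "pderiv_fps fps_y = 1"
  by (simp add: fps_y_def)

lemma weber_riccati_fps_unique:
  assumes "weber_riccati_fps w c" "weber_riccati_fps w d"
  shows "c = d"
proof -
  define P Q :: "complex poly fps" where
    "P = - (fps_y * (fps_y + 1) * (c + d - (2 * fps_y + 1)))" and "Q = 2 * (fps_y * (fps_y + 1)) ^ 2"
  have "c - d = fps_X * (P * (c - d) + Q * pderiv_fps (c - d))"
    using assms unfolding weber_riccati_fps_def P_def Q_def pderiv_fps_diff by algebra
  then have "c - d = 0" by (rule linear_fps_ode_unique)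
  then show ?thesis by simp
qed

section \<open>The coefficients as polynomials in y and w\<close>

definition biv_y :: "complex poly poly" where "biv_y = [:y_poly:]"

text \<open>
  The coefficients \<open>c\<^sub>n\<close>, as polynomials in \<open>w\<close> (the outer variable) whose coefficients are
  polynomials in \<open>y\<close>; the recursion is the Riccati equation read off order by order. In this nesting,
  fixing \<open>w\<close> is evaluation at a constant polynomial, \<open>d/dw\<close> is \<^const>\<open>pderiv\<close>, and \<open>d/dy\<close> acts
  on the coefficients.
\<close>

fun weber_c :: "nat \<Rightarrow> complex poly poly" where
  "weber_c 0 = [:[:-1, -1:], 1:]"
| "weber_c (Suc n) = - (biv_y * (biv_y + 1)) * ((\<Sum>i\<le>n. weber_c i * weber_c (n - i)) -
     (2 * biv_y + 1) * weber_c n - 2 * (biv_y * (biv_y + 1)) * map_poly pderiv (weber_c n))"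

text \<open>
  The index is one less than the order in \<open>h\<close>: \<open>weber_r n\<close> is the density \<open>r\<^bsub>n+1\<^esub>\<close>.
\<close>

definition weber_r :: "nat \<Rightarrow> complex poly poly" where
  "weber_r n = smult [:1 / 2:] ((\<Sum>i\<le>n. weber_c i * weber_c (n - i)) -
     (2 * biv_y + 1) * weber_c n - 2 * (biv_y * (biv_y + 1)) * map_poly pderiv (weber_c n))"

declare weber_c.simps(2) [simp del]

lemma two_times_smult_half: "2 * smult [:1 / 2:] P = (P :: complex poly poly)"
proof -
  have "2 * smult [:1 / 2:] P = smult [:1 / 2:] P + smult [:1 / 2:] P" by (simp only: mult_2)
  also have "\<dots> = smult ([:1 / 2:] + [:1 / 2:]) P" by (simp only: smult_add_left)
  also have "[:1 / 2:] + [:1 / 2:] = (1 :: complex poly)" by (simp add: one_pCons)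
  finally show ?thesis by simp
qed

lemma weber_c_Suc: "weber_c (Suc n) = - 2 * (biv_y * (biv_y + 1)) * weber_r n"
proof -
  have "- 2 * (biv_y * (biv_y + 1)) * weber_r n = - (biv_y * (biv_y + 1)) * (2 * weber_r n)"
    by (simp add: algebra_simps)
  then show ?thesis
    unfolding weber_r_def two_times_smult_half weber_c.simps(2) by simp
qed

lemma map_poly_pderiv_pCons [simp]: "map_poly pderiv (pCons a P) = pCons (pderiv a) (map_poly pderiv P)"
  for P :: "complex poly poly"
  by (rule poly_eqI) (simp add: coeff_map_poly coeff_pCons split: nat.split)

lemma pderiv_poly_biv: "pderiv (poly P [:w:]) = poly (map_poly pderiv P) [:w:]"
  for P :: "complex poly poly"
  by (induction P) (simp_all add: pderiv_add pderiv_mult pderiv_smult del: mult_pCons_left)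

lemma pderiv_map_poly_pderiv: "pderiv (map_poly pderiv P) = map_poly pderiv (pderiv P)"
  for P :: "complex poly poly"
  by (rule poly_eqI) (simp add: coeff_pderiv coeff_map_poly pderiv_mult del: of_nat_Suc)

lemma poly_biv_y [simp]: "poly biv_y x = y_poly"
  by (simp add: biv_y_def)

lemma poly_y_poly [simp]: "poly y_poly x = x"
  by (simp add: y_poly_def)

lemma y_times_y_plus_1_nonzero: "y_poly * (y_poly + 1) \<noteq> 0"
  by (auto simp: y_poly_def one_pCons)

lemma poly_weber_c_0: "poly (weber_c 0) [:w:] = [:w:] - y_poly - 1"
  by (simp add: y_poly_def one_pCons)

lemma poly_weber_c_Suc: "poly (weber_c (Suc n)) [:w:] = - (y_poly * (y_poly + 1)) *
    ((\<Sum>i\<le>n. poly (weber_c i) [:w:] * poly (weber_c (n - i)) [:w:]) -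
     (2 * y_poly + 1) * poly (weber_c n) [:w:] - 2 * (y_poly * (y_poly + 1)) * pderiv (poly (weber_c n) [:w:]))"
  unfolding weber_c.simps(2) pderiv_poly_biv
  by (simp add: poly_sum del: poly_pCons)

lemma poly_weber_c_Suc_r: "poly (weber_c (Suc n)) [:w:] = - 2 * (y_poly * (y_poly + 1)) * poly (weber_r n) [:w:]"
  unfolding weber_c_Suc by (simp del: poly_pCons)

definition weber_fps :: "complex \<Rightarrow> complex poly fps" where
  "weber_fps w = Abs_fps (\<lambda>n. poly (weber_c n) [:w:])"

lemma fps_y_times_y_plus_1: "fps_y * (fps_y + 1) = fps_const (y_poly * (y_poly + 1))"
  by (simp add: fps_y_def flip: fps_const_1_eq_1)

lemma fps_2_y_plus_1: "2 * fps_y + 1 = fps_const (2 * y_poly + 1)"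
  by (simp add: fps_y_def fps_numeral_fps_const flip: fps_const_1_eq_1)

lemma weber_fps_riccati: "weber_riccati_fps w (weber_fps w)"
  unfolding weber_riccati_fps_def
proof (rule fps_ext)
  fix n
  have q2: "2 * fps_const (y_poly * (y_poly + 1)) = fps_const (2 * (y_poly * (y_poly + 1)))"
    by (simp add: fps_numeral_fps_const)
  show "fps_nth (weber_fps w) n = fps_nth (fps_const [:w:] - fps_y - 1 - fps_X * (fps_y * (fps_y + 1)) *
       (weber_fps w ^ 2 - (2 * fps_y + 1) * weber_fps w - 2 * (fps_y * (fps_y + 1)) * pderiv_fps (weber_fps w))) n"
  proof (cases n)
    case 0
    then show ?thesis
      by (simp add: weber_fps_def poly_weber_c_0 fps_y_def mult.assoc del: weber_c.simps)
  next
    case (Suc k)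
    then show ?thesis
      unfolding fps_y_times_y_plus_1 fps_2_y_plus_1 q2
      by (simp add: weber_fps_def poly_weber_c_Suc fps_y_def mult.assoc power2_eq_square
        fps_mult_nth [of "Abs_fps _" "Abs_fps _"] atLeast0AtMost)
  qed
qed

section \<open>The ladder operator: raising w by one\<close>

text \<open>
  Eliminating \<open>c'\<close> by the Riccati equation turns the differential ladder relation into an algebraic
  one between \<open>c\<close> and its shift \<open>c + 1 - 2 y (y + 1) G\<close>, where \<open>G\<close> is the logarithmic derivative of
  \<open>1 + h y c\<close>. It is the three-term contiguity relation of parabolic cylinder functions in disguise.
\<close>

lemma contiguity_relation:
  fixes y :: "'a::idom"
  assumes "c = w - y - 1 - h * (y * (y + 1)) * (c ^ 2 - (2 * y + 1) * c - 2 * (y * (y + 1)) * c')"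
    and "(1 + h * y * c) * G = h * (c + y * c')"
  shows "(y + 1) * (1 + h * y * c) * (c + 1 - 2 * (y * (y + 1)) * G) = y * c + w"
  using assms by algebra

text \<open>
  The shifted function \<open>b\<close> solves the Riccati equation with \<open>w + 1\<close>. After multiplication by
  \<open>(y + 1) (1 + h y c)\<close> the derivative \<open>b'\<close> can be eliminated by the differentiated contiguity relation
  and \<open>c'\<close> by the definition of \<open>b\<close>; what remains is a multiple of the contiguity relation itself.
\<close>

lemma contiguity_preserves_riccati:
  fixes y :: "'a::idom"
  assumes J: "(y + 1) * (1 + h * y * c) * b = y * c + w"
    and J': "(1 + h * y * c) * b + (y + 1) * h * (c + y * c') * b + (y + 1) * (1 + h * y * c) * b' = c + y * c'"
    and G: "(1 + h * y * c) * G = h * (c + y * c')"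
    and b: "b = c + 1 - 2 * (y * (y + 1)) * G"
    and nz: "(y + 1) * (1 + h * y * c) \<noteq> 0"
  shows "b = (w + 1) - y - 1 - h * (y * (y + 1)) * (b ^ 2 - (2 * y + 1) * b - 2 * (y * (y + 1)) * b')"
proof -
  define A where "A = 1 + h * y * c"
  \<comment> \<open>the definition of \<open>b\<close>, solved for the logarithmic derivative\<close>
  have G2: "2 * (y * (y + 1)) * (h * (c + y * c')) = A * (1 + c - b)"
    unfolding G [symmetric] A_def b by (simp add: algebra_simps)
  have b': "(y + 1) * A * b' = (c + y * c') * (1 - h * (y + 1) * b) - A * b"
    using J' unfolding A_def by (simp add: algebra_simps)
  have "2 * h * (y * (y + 1)) ^ 2 * ((y + 1) * A * b') =
      (y * (y + 1)) * (2 * (y * (y + 1)) * (h * (c + y * c'))) * (1 - h * (y + 1) * b)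
      - 2 * h * (y * (y + 1)) ^ 2 * A * b"
    unfolding b' by algebra
  also have "\<dots> = (y * (y + 1)) * (A * (1 + c - b)) * (1 - h * (y + 1) * b)
      - 2 * h * (y * (y + 1)) ^ 2 * A * b"
    unfolding G2 ..
  finally have key: "2 * h * (y * (y + 1)) ^ 2 * ((y + 1) * A * b') = \<dots>" .
  have "(y + 1) * A * (b - ((w + 1) - y - 1 - h * (y * (y + 1)) * (b ^ 2 - (2 * y + 1) * b - 2 * (y * (y + 1)) * b')))
      = (y + 1) * A * (b - w + y + h * (y * (y + 1)) * (b ^ 2 - (2 * y + 1) * b))
        - 2 * h * (y * (y + 1)) ^ 2 * ((y + 1) * A * b')"
    by algebra
  also have "\<dots> = A * (y + 1) * ((y + 1) * (1 + h * y * c) * b - (y * c + w))"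
    unfolding key by algebra
  also have "\<dots> = 0" by (simp add: J)
  finally have "(y + 1) * (1 + h * y * c) * (b - ((w + 1) - y - 1 - h * (y * (y + 1)) *
      (b ^ 2 - (2 * y + 1) * b - 2 * (y * (y + 1)) * b'))) = 0"
    unfolding A_def .
  then show ?thesis using nz by simp
qed

lemma weber_riccati_fps_shift:
  assumes c: "weber_riccati_fps w c"
    and G: "(1 + fps_X * fps_y * c) * G = pderiv_fps (1 + fps_X * fps_y * c)"
  shows "weber_riccati_fps (w + 1) (c + 1 - 2 * (fps_y * (fps_y + 1)) * G)" (is "weber_riccati_fps _ ?b")
proof -
  have dA: "pderiv_fps (1 + fps_X * fps_y * c) = fps_X * (c + fps_y * pderiv_fps c)"
    by (simp add: pderiv_fps_add pderiv_fps_mult pderiv_fps_y) (simp add: algebra_simps)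
  define A where "A = 1 + fps_X * fps_y * c"
  define b where "b = ?b"
  have J: "(fps_y + 1) * A * b = fps_y * c + fps_const [:w:]"
    unfolding A_def b_def
    by (rule contiguity_relation [OF c [unfolded weber_riccati_fps_def] G [unfolded dA]])
  have "pderiv_fps ((fps_y + 1) * A * b) = pderiv_fps (fps_y * c + fps_const [:w:])"
    by (simp only: J)
  then have J': "A * b + (fps_y + 1) * fps_X * (c + fps_y * pderiv_fps c) * b
      + (fps_y + 1) * A * pderiv_fps b = c + fps_y * pderiv_fps c"
    by (simp add: pderiv_fps_add pderiv_fps_mult dA [folded A_def] algebra_simps)
  have "fps_nth ((fps_y + 1) * (1 + fps_X * fps_y * c)) 0 \<noteq> 0"
    by (simp add: fps_y_def y_poly_def one_pCons)
  then have nz: "(fps_y + 1) * (1 + fps_X * fps_y * c) \<noteq> 0" by (metis fps_zero_nth)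
  have w: "fps_const [:w + 1:] = fps_const [:w:] + (1 :: complex poly fps)"
    by (simp add: one_pCons flip: fps_const_1_eq_1)
  show ?thesis
    unfolding weber_riccati_fps_def w
    by (rule contiguity_preserves_riccati [OF J [unfolded A_def b_def] J' [unfolded A_def b_def] G [unfolded dA] refl nz])
qed

text \<open>
  The difference \<open>c(w + 1) - c(w)\<close> is \<open>1 - 2 y (y + 1) G\<close>. The \<open>1\<close> is of order \<open>0\<close> in \<open>h\<close>, and in higher
  order both sides contain the factor \<open>-2 y (y + 1)\<close>, which cancels.
\<close>

lemma weber_r_shift:
  assumes "(1 + fps_X * fps_y * weber_fps w) * G = pderiv_fps (1 + fps_X * fps_y * weber_fps w)"
  shows "poly (weber_r n) [:w + 1:] - poly (weber_r n) [:w:] = fps_nth G (Suc n)"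
proof -
  have "weber_fps (w + 1) = weber_fps w + 1 - 2 * (fps_y * (fps_y + 1)) * G"
    by (rule weber_riccati_fps_unique [OF weber_fps_riccati weber_riccati_fps_shift [OF weber_fps_riccati assms]])
  also have "2 * (fps_y * (fps_y + 1)) = fps_const (2 * (y_poly * (y_poly + 1)))"
    unfolding fps_y_times_y_plus_1 by (simp add: fps_numeral_fps_const)
  finally have "fps_nth (weber_fps (w + 1)) (Suc n) =
      fps_nth (weber_fps w + 1 - fps_const (2 * (y_poly * (y_poly + 1))) * G) (Suc n)"
    by simp
  then have "2 * (y_poly * (y_poly + 1)) * (poly (weber_r n) [:w + 1:] - poly (weber_r n) [:w:]) =
      2 * (y_poly * (y_poly + 1)) * fps_nth G (Suc n)"
    by (simp add: weber_fps_def poly_weber_c_Suc_r algebra_simps)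
  then show ?thesis
    using y_times_y_plus_1_nonzero by (metis mult_cancel_left mult_eq_0_iff zero_neq_numeral)
qed

text \<open>
  Both sides are the mixed second derivative of \<open>log A\<close>, as \<open>G\<close> and \<open>M\<close> are the logarithmic derivatives
  of \<open>A\<close> in \<open>y\<close> and in \<open>h\<close>. Working with these two avoids the logarithm itself.
\<close>

lemma log_deriv_commute:
  assumes G: "A * G = pderiv_fps A" and M: "A * M = fps_euler A" and nz: "A \<noteq> 0"
  shows "fps_euler G = pderiv_fps M"
proof -
  have 1: "fps_euler A * G + A * fps_euler G = fps_euler (pderiv_fps A)"
    by (simp flip: G fps_euler_mult)
  have 2: "pderiv_fps A * M + A * pderiv_fps M = fps_euler (pderiv_fps A)"
    by (simp flip: M pderiv_fps_mult pderiv_fps_euler)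
  have 3: "fps_euler A * G = pderiv_fps A * M"
    by (simp add: mult_ac flip: G M)
  have "A * fps_euler G = A * pderiv_fps M"
    using 1 2 unfolding 3 by (metis add_left_cancel)
  then show ?thesis using nz by simp
qed

text \<open>
  Up to the factor \<open>n + 1\<close>, a primitive of the shift is the coefficient of \<open>M = h (dA/dh) / A\<close>, with
  \<open>A = 1 + h y c\<close>. Its end values follow from \<open>A = 1\<close> at \<open>y = 0\<close> and \<open>A = 1 - h w\<close> at \<open>y = -1\<close>: there
  \<open>M\<close> is \<open>0\<close> and \<open>- h w / (1 - h w)\<close>.
\<close>

lemma weber_r_shift_primitive:
  obtains M where "\<And>n. smult (of_nat (Suc n)) (poly (weber_r n) [:w + 1:] - poly (weber_r n) [:w:]) = pderiv (M n)"
    and "\<And>n. poly (M n) 0 = 0" and "\<And>n. poly (M n) (-1) = - (w ^ Suc n)"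
proof -
  define A where "A = 1 + fps_X * fps_y * weber_fps w"
  define B where "B = fps_right_inverse A 1"
  have B: "A * B = 1"
    unfolding B_def by (rule fps_right_inverse) (simp add: A_def)
  define G where "G = B * pderiv_fps A"
  define M where "M = B * fps_euler A"
  have G: "A * G = pderiv_fps A" and M: "A * M = fps_euler A"
    by (simp_all add: G_def M_def B flip: mult.assoc)
  have nz: "A \<noteq> 0" using B by auto
  have GM: "fps_euler G = pderiv_fps M" by (rule log_deriv_commute [OF G M nz])
  have M0: "fps_nth M 0 = 0"
    using M B by (simp add: M_def fps_euler_nth)
  have "A * M = M + fps_X * (fps_const y_poly * (weber_fps w * M))"
    by (simp add: A_def fps_y_def algebra_simps)
  then have M_eq: "M = fps_euler A - fps_X * (fps_const y_poly * (weber_fps w * M))"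
    unfolding M by (simp add: algebra_simps)
  have MS: "fps_nth M (Suc n) = of_nat (Suc n) * (y_poly * poly (weber_c n) [:w:])
      - y_poly * (\<Sum>i=0..n. poly (weber_c i) [:w:] * fps_nth M (n - i))" for n
  proof -
    have "fps_nth M (Suc n) = fps_nth (fps_euler A - fps_X * (fps_const y_poly * (weber_fps w * M))) (Suc n)"
      by (rule arg_cong [OF M_eq])
    also have "\<dots> = of_nat (Suc n) * (y_poly * poly (weber_c n) [:w:])
      - y_poly * (\<Sum>i=0..n. poly (weber_c i) [:w:] * fps_nth M (n - i))"
      by (simp add: fps_euler_nth A_def mult.assoc fps_y_def fps_mult_nth [of "weber_fps w" M])
        (simp add: weber_fps_def)
    finally show ?thesis .
  qed
  \<comment> \<open>At \<open>y = -1\<close> only \<open>c\<^sub>0 = w\<close> survives, so the recursion for \<open>M\<close> collapses to multiplication by \<open>w\<close>.\<close>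
  have c0: "poly (poly (weber_c 0) [:w:]) (-1) = w"
    by simp
  have cS: "poly (poly (weber_c (Suc n)) [:w:]) (-1) = 0" for n
    by (simp add: poly_weber_c_Suc_r del: poly_pCons)
  have cS': "poly (poly (weber_c i) [:w:]) (-1) = 0" if "Suc 0 \<le> i" for i
    using cS [of "i - 1"] that by simp
  have "poly (fps_nth M (Suc n)) (-1) = - (w ^ Suc n)" for n
  proof (induction n)
    case 0
    show ?case by (simp add: MS M0)
  next
    case (Suc n)
    have "poly (fps_nth M (Suc (Suc n))) (-1) =
      (\<Sum>i=0..Suc n. poly (poly (weber_c i) [:w:]) (-1) * poly (fps_nth M (Suc n - i)) (-1))"
      by (subst MS) (simp add: poly_sum cS del: weber_c.simps of_nat_Suc poly_pCons sum.atLeast0_atMost_Suc)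
    also have "\<dots> = w * poly (fps_nth M (Suc n)) (-1)"
      using cS' by (subst sum.atLeast_Suc_atMost) (auto simp: c0 simp del: weber_c.simps intro!: sum.neutral)
    finally show ?case using Suc by simp
  qed
  moreover have "poly (fps_nth M (Suc n)) 0 = 0" for n
    by (simp add: MS)
  moreover have "smult (of_nat (Suc n)) (poly (weber_r n) [:w + 1:] - poly (weber_r n) [:w:]) = pderiv (fps_nth M (Suc n))" for n
  proof -
    have "fps_nth (fps_euler G) (Suc n) = fps_nth (pderiv_fps M) (Suc n)" by (simp only: GM)
    then show ?thesis
      unfolding weber_r_shift [OF G [unfolded A_def]]
      by (simp add: fps_euler_nth of_nat_poly del: of_nat_Suc)
  qed
  ultimately show ?thesis using that [of "\<lambda>n. fps_nth M (Suc n)"] by blast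
qed

section \<open>The derivative with respect to w\<close>

definition weber_fps_dw :: "complex \<Rightarrow> complex poly fps" where
  "weber_fps_dw w = Abs_fps (\<lambda>n. poly (pderiv (weber_c n)) [:w:])"

lemma pderiv_biv_y [simp]: "pderiv biv_y = 0" by (simp add: biv_y_def)

lemma pderiv_numeral_mult: "pderiv (numeral k * P) = numeral k * pderiv (P :: 'a::idom poly)"
  by (simp add: numeral_poly pderiv_smult)

lemma poly_pderiv_weber_c_Suc: "poly (pderiv (weber_c (Suc n))) [:w:] = - (y_poly * (y_poly + 1)) *
    (2 * (\<Sum>i\<le>n. poly (weber_c i) [:w:] * poly (pderiv (weber_c (n - i))) [:w:]) -
     (2 * y_poly + 1) * poly (pderiv (weber_c n)) [:w:]
     - 2 * (y_poly * (y_poly + 1)) * pderiv (poly (pderiv (weber_c n)) [:w:]))"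
proof -
  have "(\<Sum>i\<le>n. weber_c (n - i) * pderiv (weber_c i)) = (\<Sum>i\<le>n. weber_c i * pderiv (weber_c (n - i)))"
    by (rule sum.reindex_bij_witness [of _ "\<lambda>i. n - i" "\<lambda>i. n - i"]) auto
  then have s: "pderiv (\<Sum>i\<le>n. weber_c i * weber_c (n - i)) =
     2 * (\<Sum>i\<le>n. weber_c i * pderiv (weber_c (n - i)))"
    by (simp add: pderiv_sum pderiv_mult sum.distrib)
  have q: "pderiv (biv_y * (biv_y + 1)) = 0" by (simp add: pderiv_mult pderiv_add)
  have q2: "pderiv (2 * (biv_y * (biv_y + 1))) = 0" by (simp add: pderiv_numeral_mult q)
  have p: "pderiv (2 * biv_y + 1) = 0" by (simp add: pderiv_add pderiv_numeral_mult)
  show ?thesis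
    unfolding weber_c.simps(2) pderiv_poly_biv
    unfolding pderiv_minus pderiv_mult [of "- (biv_y * (biv_y + 1))"] q pderiv_diff s pderiv_mult [of "2 * biv_y + 1"] p
      pderiv_mult [of "2 * (biv_y * (biv_y + 1))"] q2 pderiv_map_poly_pderiv
    by (simp add: poly_sum del: poly_pCons)
qed

text \<open>
  The derivative of the Riccati equation with respect to \<open>w\<close>; the unknown \<open>t\<close> is \<open>dc/dw\<close>.
\<close>

definition linearized_riccati :: "complex poly fps \<Rightarrow> complex poly fps \<Rightarrow> bool" where
  "linearized_riccati c t \<longleftrightarrow> t = 1 - fps_X * (fps_y * (fps_y + 1)) *
     (2 * c * t - (2 * fps_y + 1) * t - 2 * (fps_y * (fps_y + 1)) * pderiv_fps t)"

lemma linearized_riccati_unique: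
  assumes "linearized_riccati c t" "linearized_riccati c u"
  shows "t = u"
proof -
  define P Q :: "complex poly fps" where
    "P = - (fps_y * (fps_y + 1) * (2 * c - (2 * fps_y + 1)))" and "Q = 2 * (fps_y * (fps_y + 1)) ^ 2"
  have "t - u = fps_X * (P * (t - u) + Q * pderiv_fps (t - u))"
    using assms unfolding linearized_riccati_def P_def Q_def pderiv_fps_diff by algebra
  then have "t - u = 0" by (rule linear_fps_ode_unique)
  then show ?thesis by simp
qed

lemma weber_fps_dw_linearized: "linearized_riccati (weber_fps w) (weber_fps_dw w)"
  unfolding linearized_riccati_def
proof (rule fps_ext)
  fix n
  have q2: "2 * fps_const (y_poly * (y_poly + 1)) = fps_const (2 * (y_poly * (y_poly + 1)))"
    by (simp add: fps_numeral_fps_const)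
  have c2: "2 * weber_fps w * weber_fps_dw w = fps_const 2 * (weber_fps w * weber_fps_dw w)"
    by (simp add: fps_numeral_fps_const mult.assoc)
  show "fps_nth (weber_fps_dw w) n = fps_nth (1 - fps_X * (fps_y * (fps_y + 1)) *
     (2 * weber_fps w * weber_fps_dw w - (2 * fps_y + 1) * weber_fps_dw w
      - 2 * (fps_y * (fps_y + 1)) * pderiv_fps (weber_fps_dw w))) n"
  proof (cases n)
    case 0
    then show ?thesis
      by (simp add: weber_fps_dw_def mult.assoc pderiv_pCons)
  next
    case (Suc k)
    then show ?thesis
      unfolding fps_y_times_y_plus_1 fps_2_y_plus_1 q2 c2
      by (simp add: weber_fps_dw_def weber_fps_def poly_pderiv_weber_c_Suc fps_y_def mult.assoc
        fps_mult_nth [of "Abs_fps _" "Abs_fps _"] atLeast0AtMost)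
  qed
qed

text \<open>
  Read \<open>e\<close> as the Euler derivative \<open>h dc/dh\<close> and primes as \<open>d/dy\<close>. Then \<open>t\<close> is what \<open>dc/dw\<close> has to be,
  since \<open>\<lambda>\<close> and \<open>\<nu>\<close> enter the Weber equation only through \<open>\<lambda> - \<hbar> \<nu> / 2\<close>, and a rescaling of \<open>\<lambda>\<close> acts on
  \<open>h\<close> and, at fixed \<open>x\<close>, on \<open>y\<close>. That \<open>t\<close> solves the linearized equation follows from the derivatives of
  the Riccati equation in \<open>y\<close> and in \<open>h\<close>, which express the second-order terms \<open>c''\<close> and \<open>e'\<close> by
  \<open>c\<close>, \<open>c'\<close> and \<open>e\<close>.
\<close>

lemma linearized_riccati_identity:
  fixes y :: "'a::idom"
  assumes E': "c' = - 1 - h * (2 * y + 1) * (c ^ 2 - (2 * y + 1) * c - 2 * (y * (y + 1)) * c')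
      - h * (y * (y + 1)) * (2 * c * c' - 2 * c - (2 * y + 1) * c' - 2 * (2 * y + 1) * c' - 2 * (y * (y + 1)) * c'')"
    and Eh: "e = - h * (y * (y + 1)) * (c ^ 2 - (2 * y + 1) * c - 2 * (y * (y + 1)) * c')
      - h * (y * (y + 1)) * (2 * c * e - (2 * y + 1) * e - 2 * (y * (y + 1)) * e')"
    and T: "t = 1 + h * (e - 2 * (y * (y + 1)) * c - y * (y + 1) * (2 * y + 1) * c')"
    and T': "t' = h * (e' - 2 * (2 * y + 1) * c - 2 * (y * (y + 1)) * c'
      - ((2 * y + 1) ^ 2 + 2 * (y * (y + 1))) * c' - y * (y + 1) * (2 * y + 1) * c'')"
  shows "t = 1 - h * (y * (y + 1)) * (2 * c * t - (2 * y + 1) * t - 2 * (y * (y + 1)) * t')"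
proof -
  define N where "N = c ^ 2 - (2 * y + 1) * c - 2 * (y * (y + 1)) * c'"
  define P where "P = e + h * (y * (y + 1)) * N + h * (y * (y + 1)) * (2 * c * e - (2 * y + 1) * e)"
  define Q where "Q = c' + 1 + h * (2 * y + 1) * N
    + h * (y * (y + 1)) * (2 * c * c' - 2 * c - 3 * (2 * y + 1) * c')"
  have P: "2 * h * (y * (y + 1)) ^ 2 * e' = P"
    using Eh unfolding N_def P_def by algebra
  have Q: "2 * h * (y * (y + 1)) ^ 2 * c'' = Q"
    using E' unfolding N_def Q_def by algebra
  have "t - (1 - h * (y * (y + 1)) * (2 * c * t - (2 * y + 1) * t - 2 * (y * (y + 1)) * t'))
    = h * (y * (y + 1)) * (2 * y + 1) * (2 * h * (y * (y + 1)) ^ 2 * c'' - Q)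
      - h * (2 * h * (y * (y + 1)) ^ 2 * e' - P)"
    unfolding T T' N_def P_def Q_def by algebra
  then show ?thesis unfolding P Q by simp
qed

lemma weber_fps_dw_eq:
  "weber_fps_dw w = 1 + fps_X * (fps_euler (weber_fps w) - 2 * (fps_y * (fps_y + 1)) * weber_fps w
     - fps_y * (fps_y + 1) * (2 * fps_y + 1) * pderiv_fps (weber_fps w))" (is "_ = ?t")
proof (rule linearized_riccati_unique [OF weber_fps_dw_linearized])
  define c where "c = weber_fps w"
  have c: "c = fps_const [:w:] - fps_y - 1 - fps_X * (fps_y * (fps_y + 1)) *
       (c ^ 2 - (2 * fps_y + 1) * c - 2 * (fps_y * (fps_y + 1)) * pderiv_fps c)"
    using weber_fps_riccati unfolding weber_riccati_fps_def c_def .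
  have ey: "fps_euler fps_y = 0" by (simp add: fps_y_def)
  have E: "pderiv_fps c = - 1 - fps_X * (2 * fps_y + 1) * (c ^ 2 - (2 * fps_y + 1) * c - 2 * (fps_y * (fps_y + 1)) * pderiv_fps c)
      - fps_X * (fps_y * (fps_y + 1)) * (2 * c * pderiv_fps c - 2 * c - (2 * fps_y + 1) * pderiv_fps c - 2 * (2 * fps_y + 1) * pderiv_fps c - 2 * (fps_y * (fps_y + 1)) * pderiv_fps (pderiv_fps c))"
    using arg_cong [OF c, of pderiv_fps]
    by (simp add: pderiv_fps_add pderiv_fps_diff pderiv_fps_mult power2_eq_square algebra_simps)
  have H: "fps_euler c = - fps_X * (fps_y * (fps_y + 1)) * (c ^ 2 - (2 * fps_y + 1) * c - 2 * (fps_y * (fps_y + 1)) * pderiv_fps c)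
      - fps_X * (fps_y * (fps_y + 1)) * (2 * c * fps_euler c - (2 * fps_y + 1) * fps_euler c - 2 * (fps_y * (fps_y + 1)) * pderiv_fps (fps_euler c))"
    using arg_cong [OF c, of fps_euler]
    by (simp add: fps_euler_add fps_euler_diff fps_euler_mult ey power2_eq_square pderiv_fps_euler algebra_simps)
  show "linearized_riccati (weber_fps w) ?t"
    unfolding linearized_riccati_def c_def [symmetric]
    by (rule linearized_riccati_identity [OF E H refl])
      (simp add: pderiv_fps_add pderiv_fps_diff pderiv_fps_mult power2_eq_square algebra_simps)
qed

text \<open>
  The coefficient of \<open>h\<^bsup>n+2\<^esup>\<close> in \<open>weber_fps_dw_eq\<close>, divided by \<open>-2 y (y + 1)\<close>. The terms that do not come
  from the Euler operator in \<open>h\<close> combine to an exact \<open>y\<close>-derivative.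
\<close>

lemma weber_r_dw:
  "poly (pderiv (weber_r (Suc n))) [:w:] = of_nat (Suc n) * poly (weber_r n) [:w:]
     - pderiv (y_poly * (y_poly + 1) * (2 * y_poly + 1) * poly (weber_r n) [:w:])"
proof -
  define q where "q = y_poly * (y_poly + 1)"
  define r where "r = poly (weber_r n) [:w:]"
  have qnz: "q \<noteq> 0" using y_times_y_plus_1_nonzero by (simp add: q_def)
  have dq: "pderiv q = 2 * y_poly + 1" by (simp add: q_def pderiv_mult pderiv_add algebra_simps)
  have q2: "2 * (fps_y * (fps_y + 1)) = fps_const (2 * q)"
    unfolding fps_y_times_y_plus_1 q_def by (simp add: fps_numeral_fps_const)
  have qp: "fps_y * (fps_y + 1) * (2 * fps_y + 1) = fps_const (q * (2 * y_poly + 1))"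
    unfolding fps_y_times_y_plus_1 fps_2_y_plus_1 q_def by simp
  have a: "fps_nth (weber_fps_dw w) (Suc (Suc n)) = of_nat (Suc n) * fps_nth (weber_fps w) (Suc n)
    - 2 * q * fps_nth (weber_fps w) (Suc n) - q * (2 * y_poly + 1) * pderiv (fps_nth (weber_fps w) (Suc n))"
    unfolding weber_fps_dw_eq q2 qp by (simp add: fps_euler_nth mult.assoc del: of_nat_Suc)
  have b: "fps_nth (weber_fps w) (Suc n) = - 2 * q * r"
    by (simp add: weber_fps_def poly_weber_c_Suc_r q_def r_def del: poly_pCons)
  have c: "pderiv (- 2 * q * r) = - 2 * ((2 * y_poly + 1) * r + q * pderiv r)"
    by (simp add: pderiv_minus pderiv_mult pderiv_numeral_mult dq algebra_simps)
  have d: "fps_nth (weber_fps_dw w) (Suc (Suc n)) = - 2 * q * poly (pderiv (weber_r (Suc n))) [:w:]"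
  proof -
    have "pderiv (- 2 * (biv_y * (biv_y + 1))) = 0" 
      by (simp add: pderiv_minus pderiv_mult pderiv_numeral_mult pderiv_add)
    then show ?thesis
      unfolding weber_fps_dw_def weber_c_Suc fps_nth_Abs_fps pderiv_mult [of "- 2 * (biv_y * (biv_y + 1))"] q_def
      by (simp del: poly_pCons)
  qed
  have e: "pderiv (q * (2 * y_poly + 1) * r) = 
     ((2 * y_poly + 1) * (2 * y_poly + 1) + 2 * q) * r + q * (2 * y_poly + 1) * pderiv r"
    by (simp add: pderiv_mult pderiv_numeral_mult pderiv_add dq algebra_simps)
  have "2 * q * poly (pderiv (weber_r (Suc n))) [:w:] = 2 * q * (of_nat (Suc n) * r - pderiv (q * (2 * y_poly + 1) * r))"
    using a unfolding d b c e by (simp add: algebra_simps del: of_nat_Suc)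
  then show ?thesis
    using qnz unfolding q_def r_def by (metis mult_cancel_left mult_eq_0_iff zero_neq_numeral)
qed

section \<open>Integration over y and the polynomials v\<close>

definition poly_primitive :: "complex poly \<Rightarrow> complex poly" where
  "poly_primitive p = (\<Sum>i\<le>degree p. monom (coeff p i / of_nat (Suc i)) (Suc i))"

lemma pderiv_poly_primitive [simp]: "pderiv (poly_primitive p) = p"
  by (simp add: poly_primitive_def pderiv_sum pderiv_monom poly_as_sum_of_monoms del: of_nat_Suc)

text \<open>
  The limits of integration are the values of \<open>y\<close> at the ends \<open>z = 0\<close> and \<open>z = \<infinity>\<close> of the path.
\<close>

definition integral_m1_0 :: "complex poly \<Rightarrow> complex" where
  "integral_m1_0 p = poly (poly_primitive p) 0 - poly (poly_primitive p) (-1)"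

lemma integral_m1_0_pderiv: "integral_m1_0 (pderiv P) = poly P 0 - poly P (-1)"
proof -
  have "pderiv (poly_primitive (pderiv P) - P) = 0" by (simp add: pderiv_diff)
  then obtain h where "poly_primitive (pderiv P) - P = [:h:]" by (auto dest: pderiv_iszero)
  then have "poly_primitive (pderiv P) = P + [:h:]" by (simp add: algebra_simps)
  then show ?thesis by (simp add: integral_m1_0_def)
qed

lemma integral_m1_0_add: "integral_m1_0 (p + q) = integral_m1_0 p + integral_m1_0 q"
  using integral_m1_0_pderiv [of "poly_primitive p + poly_primitive q"]
  by (simp add: pderiv_add integral_m1_0_def)

lemma integral_m1_0_diff: "integral_m1_0 (p - q) = integral_m1_0 p - integral_m1_0 q"
  using integral_m1_0_pderiv [of "poly_primitive p - poly_primitive q"]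
  by (simp add: pderiv_diff integral_m1_0_def)

lemma integral_m1_0_smult: "integral_m1_0 (smult a p) = a * integral_m1_0 p"
  using integral_m1_0_pderiv [of "smult a (poly_primitive p)"]
  by (simp add: pderiv_smult integral_m1_0_def algebra_simps)

lemma integral_m1_0_0 [simp]: "integral_m1_0 0 = 0"
  using integral_m1_0_smult [of 0 0] by simp

lemma integral_m1_0_poly: "integral_m1_0 (poly P [:w:]) = poly (map_poly integral_m1_0 P) w"
proof (induction P)
  case (pCons a P)
  have "map_poly integral_m1_0 (pCons a P) = pCons (integral_m1_0 a) (map_poly integral_m1_0 P)"
    by (rule poly_eqI) (simp add: coeff_map_poly coeff_pCons split: nat.split)
  then show ?case
    using pCons by (simp add: integral_m1_0_add integral_m1_0_smult)
qed simp

lemma pderiv_map_integral: "pderiv (map_poly integral_m1_0 P) = map_poly integral_m1_0 (pderiv P)"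
  by (rule poly_eqI)
    (simp add: coeff_pderiv coeff_map_poly of_nat_poly integral_m1_0_smult del: of_nat_Suc)

text \<open>
  Integrating coefficientwise keeps the result a polynomial in \<open>w\<close>, which is essential for
  the periodicity argument below: an entire periodic function need not be constant. The index is
  shifted as for \<open>weber_r\<close>.
\<close>

definition weber_v :: "nat \<Rightarrow> complex poly" where
  "weber_v n = map_poly integral_m1_0 (weber_r n)"

lemma poly_weber_v: "poly (weber_v n) w = integral_m1_0 (poly (weber_r n) [:w:])"
  by (simp add: weber_v_def integral_m1_0_poly del: poly_pCons)

lemma weber_v_shift: "poly (weber_v n) (w + 1) - poly (weber_v n) w = w ^ Suc n / of_nat (Suc n)"
proof -
  obtain M where M: "\<And>n. smult (of_nat (Suc n)) (poly (weber_r n) [:w + 1:] - poly (weber_r n) [:w:]) = pderiv (M n)"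
    and "\<And>n. poly (M n) 0 = 0" and "\<And>n. poly (M n) (-1) = - (w ^ Suc n)"
    by (rule weber_r_shift_primitive [of w]) blast
  then have "of_nat (Suc n) * (poly (weber_v n) (w + 1) - poly (weber_v n) w) = w ^ Suc n"
    using integral_m1_0_pderiv [of "M n"] unfolding M [symmetric]
    by (simp add: integral_m1_0_smult integral_m1_0_diff poly_weber_v del: of_nat_Suc)
  then show ?thesis by (simp add: field_simps del: of_nat_Suc)
qed

text \<open>
  The polynomial under the \<open>y\<close>-derivative in \<open>weber_r_dw\<close> vanishes at both ends \<open>y = 0\<close> and
  \<open>y = -1\<close>, so it contributes nothing to the integral.
\<close>

lemma pderiv_weber_v: "pderiv (weber_v (Suc n)) = smult (of_nat (Suc n)) (weber_v n)"
proof -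
  have "poly (pderiv (weber_v (Suc n))) w = poly (smult (of_nat (Suc n)) (weber_v n)) w" for w
  proof -
    have "poly (pderiv (weber_v (Suc n))) w = integral_m1_0 (poly (pderiv (weber_r (Suc n))) [:w:])"
      by (simp add: weber_v_def pderiv_map_integral integral_m1_0_poly del: poly_pCons)
    also have "\<dots> = of_nat (Suc n) * poly (weber_v n) w"
      unfolding weber_r_dw
      by (simp add: integral_m1_0_diff integral_m1_0_pderiv of_nat_poly integral_m1_0_smult poly_weber_v
        del: of_nat_Suc poly_pCons)
    finally show ?thesis by simp
  qed
  then show ?thesis by (simp add: poly_eq_poly_eq_iff [symmetric] fun_eq_iff)
qed

section \<open>Bernoulli polynomials\<close>

text \<open>
  Coefficients in \<open>w\<close> of \<^const>\<open>bernoulli_polynomial\<close>, from expanding \<open>e\<^bsup>wX\<^esup>\<close>; the numbers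
  \<open>k! [X^k] X / (e\<^bsup>X\<^esup> - 1)\<close> are the Bernoulli numbers.
\<close>

definition bernoulli_poly :: "nat \<Rightarrow> complex poly" where
  "bernoulli_poly n = (\<Sum>k\<le>n. monom (fact n * fps_nth (fps_X / (fps_exp 1 - 1)) k / fact (n - k)) (n - k))"

lemma bernoulli_fps: "fps_X * fps_exp w / (fps_exp 1 - 1) = fps_X / (fps_exp 1 - 1) * fps_exp (w::complex)"
  and bernoulli_fps_mult: "fps_X / (fps_exp 1 - 1) * (fps_exp (1::complex) - 1) = fps_X"
proof -
  have sub: "subdegree (fps_exp (1::complex) - 1) = 1"
    by (rule subdegreeI) auto
  have nz: "fps_exp (1::complex) - 1 \<noteq> 0"
    using sub by auto
  have d: "(fps_exp (1::complex) - 1) dvd fps_X"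
    using nz sub by (simp add: fps_dvd_iff)
  show "fps_X / (fps_exp 1 - 1) * (fps_exp (1::complex) - 1) = fps_X"
    using d by simp
  show "fps_X * fps_exp w / (fps_exp 1 - 1) = fps_X / (fps_exp 1 - 1) * fps_exp (w::complex)"
    using d by (simp add: div_mult_swap mult.commute)
qed

lemma bernoulli_polynomial_poly: "bernoulli_polynomial n w = poly (bernoulli_poly n) w"
  unfolding bernoulli_polynomial_def bernoulli_fps bernoulli_poly_def
  unfolding fps_mult_nth
  by (simp add: poly_sum poly_monom sum_distrib_left atLeast0AtMost mult_ac)

lemma bernoulli_poly_shift:
  "poly (bernoulli_poly (Suc n)) (w + 1) - poly (bernoulli_poly (Suc n)) w = of_nat (Suc n) * w ^ n"
proof -
  have "fps_X * fps_exp (w + 1) / (fps_exp 1 - 1) - fps_X * fps_exp w / (fps_exp 1 - 1)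
     = (fps_X / (fps_exp 1 - 1) * (fps_exp (1::complex) - 1)) * fps_exp w"
    unfolding bernoulli_fps [of "w + 1"] bernoulli_fps [of w]
    unfolding fps_exp_add_mult by (simp add: algebra_simps)
  also have "\<dots> = fps_X * fps_exp w" unfolding bernoulli_fps_mult ..
  finally have "fact (Suc n) * fps_nth (fps_X * fps_exp (w + 1) / (fps_exp 1 - 1) - fps_X * fps_exp w / (fps_exp 1 - 1)) (Suc n)
    = fact (Suc n) * fps_nth (fps_X * fps_exp w) (Suc n)" by (simp only:)
  then show ?thesis
    unfolding bernoulli_polynomial_poly [symmetric] bernoulli_polynomial_def
    by (simp add: algebra_simps fact_Suc del: of_nat_Suc)
qed

lemma pderiv_bernoulli_poly: "pderiv (bernoulli_poly (Suc n)) = smult (of_nat (Suc n)) (bernoulli_poly n)"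
proof -
  have "pderiv (monom (fact (Suc n) * b / fact (Suc n - k)) (Suc n - k)) =
      smult (of_nat (Suc n)) (monom (fact n * b / fact (n - k)) (n - k))" if "k \<le> n" for k and b :: complex
    using that by (simp add: pderiv_monom smult_monom Suc_diff_le fact_Suc field_simps del: of_nat_Suc)
  moreover have "smult a (sum f I) = (\<Sum>i\<in>I. smult a (f i))" for a and f :: "nat \<Rightarrow> complex poly" and I
    by (induction I rule: infinite_finite_induct) (auto simp: smult_add_right)
  ultimately show ?thesis
    unfolding bernoulli_poly_def
    by (simp add: pderiv_add pderiv_sum pderiv_monom del: of_nat_Suc fact_Suc)
qed

lemma periodic_poly_pderiv_eq_0:
  fixes p :: "complex poly"
  assumes "\<And>w. poly p (w + 1) = poly p w"
  shows "pderiv p = 0"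
proof -
  have "poly p (of_nat n) = poly p 0" for n
    by (induction n) (simp_all add: assms add.commute [of 1])
  then have "range of_nat \<subseteq> {x. poly (p - [:poly p 0:]) x = 0}" by auto
  moreover have "infinite (range (of_nat :: nat \<Rightarrow> complex))"
    by (simp add: range_inj_infinite inj_of_nat)
  ultimately have "p - [:poly p 0:] = 0"
    using poly_roots_finite infinite_super by blast
  then have "p = [:poly p 0:]" by simp
  then show ?thesis by (metis pderiv_singleton)
qed

text \<open>
  The shift law fixes each polynomial up to a constant, and the derivative law recovers that constant
  from the next polynomial in the family.
\<close>

lemma weber_v_eq_bernoulli:
  "poly (weber_v n) w = bernoulli_polynomial (Suc (Suc n)) w / (of_nat (Suc n) * of_nat (Suc (Suc n)))"
proof -
  define t where "t n = smult (1 / (of_nat (Suc n) * of_nat (Suc (Suc n)))) (bernoulli_poly (Suc (Suc n)))" for n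
  have t_shift: "poly (t n) (w + 1) - poly (t n) w = w ^ Suc n / of_nat (Suc n)" for n w
    using bernoulli_poly_shift [of "Suc n" w]
    by (simp add: t_def flip: right_diff_distrib diff_divide_distrib del: of_nat_Suc)
  have t_pderiv: "pderiv (t (Suc n)) = smult (of_nat (Suc n)) (t n)" for n
    by (simp add: t_def pderiv_smult pderiv_bernoulli_poly del: of_nat_Suc)
  \<comment> \<open>Index \<open>n + 1\<close>, because the \<open>n\<close>-th difference is recovered from the derivative of the next one.\<close>
  have "poly (weber_v (Suc n) - t (Suc n)) (x + 1) = poly (weber_v (Suc n) - t (Suc n)) x" for x
    using weber_v_shift [of "Suc n" x] t_shift [of "Suc n" x] by (simp add: algebra_simps del: of_nat_Suc)
  then have "pderiv (weber_v (Suc n) - t (Suc n)) = 0"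
    by (rule periodic_poly_pderiv_eq_0)
  then have "smult (of_nat (Suc n)) (weber_v n - t n) = 0"
    by (simp add: pderiv_diff pderiv_weber_v t_pderiv smult_diff_right del: of_nat_Suc)
  then have "weber_v n = t n" by (simp del: of_nat_Suc)
  then show ?thesis by (simp add: t_def bernoulli_polynomial_poly)
qed

section \<open>The solution of the Riccati equation in closed form\<close>

definition weber_y :: "complex \<Rightarrow> complex" where "weber_y z = 1 / (z ^ 2 - 1)"

lemma weber_y_facts:
  assumes "z \<noteq> 1" "z \<noteq> -1"
  shows "weber_y z * (z ^ 2 - 1) = 1" and "weber_y z + 1 = z ^ 2 * weber_y z"
proof -
  have "z ^ 2 - 1 \<noteq> 0" using assms by (simp add: power2_eq_1_iff)
  then show "weber_y z * (z ^ 2 - 1) = 1" "weber_y z + 1 = z ^ 2 * weber_y z"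
    by (auto simp: weber_y_def field_simps)
qed

lemma weber_y_deriv:
  assumes "z \<noteq> 1" "z \<noteq> -1"
  shows "(weber_y has_field_derivative - 2 * z * weber_y z ^ 2) (at z within A)"
proof -
  have "z ^ 2 - 1 \<noteq> 0" using assms by (simp add: power2_eq_1_iff)
  then show ?thesis
    unfolding weber_y_def [abs_def]
    by (auto intro!: derivative_eq_intros simp: field_simps power2_eq_square)
qed

lemma poly_weber_y_deriv:
  assumes "z \<noteq> 1" "z \<noteq> -1"
  shows "((\<lambda>z. poly P (weber_y z)) has_field_derivative poly (pderiv P) (weber_y z) * (- 2 * z * weber_y z ^ 2)) (at z within A)"
  by (rule DERIV_chain2 [OF poly_DERIV weber_y_deriv [OF assms]])

text \<open>
  The coefficients of \<open>\<hbar>\<^bsup>n+1\<^esup>\<close> in the Riccati equation, with the two products that contain both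
  \<open>S\<^bsub>-1\<^esub>\<close> and \<open>S\<^sub>n\<close> isolated on the left; this is the recursion that determines \<open>S\<^sub>n\<close>.
\<close>

lemma riccati_coefficients:
  assumes S: "weber_riccati_solution lam s \<nu> S" and z: "z \<in> - {0, 1, -1}"
  shows "fls_nth (S z) (-1) = s / 2 * (z - 1 / z)"
    and "2 * fls_nth (S z) (-1) * fls_nth (S z) (int n) =
      (if n = 0 then \<nu> / 2 else 0) - deriv (\<lambda>w. fls_nth (S w) (int n - 1)) z / deriv (weber_x s) z
      - (\<Sum>i<n. fls_nth (S z) (int i) * fls_nth (S z) (int n - 1 - int i))"
proof -
  have low: "fls_nth (S w) m = 0" if "w \<in> - {0, 1, -1}" "m < -1" for w m
    using S that unfolding weber_riccati_solution_def by blast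
  show "fls_nth (S z) (-1) = s / 2 * (z - 1 / z)"
    using S z unfolding weber_riccati_solution_def by blast
  have op: "open (- {0, 1, -1 :: complex})"
    by (intro open_Compl finite_imp_closed) auto
  define D where "D = (\<lambda>m. deriv (\<lambda>w. fls_nth (S w) m) z / deriv (weber_x s) z)"
  \<comment> \<open>Vanishing below a fixed order is what makes the coefficients of \<^const>\<open>weber_ddx\<close> equal to \<open>D\<close>.\<close>
  have "D m = 0" if "m < -1" for m
  proof -
    have "eventually (\<lambda>w. fls_nth (S w) m = 0) (nhds z)"
      using eventually_nhds_in_open [OF op z] by eventually_elim (use low that in auto)
    then have "deriv (\<lambda>w. fls_nth (S w) m) z = deriv (\<lambda>w. 0) z"
      by (rule deriv_cong_ev) simp
    then show ?thesis by (simp add: D_def)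
  qed
  then have Dnth: "fls_nth (weber_ddx s S z) m = D m" for m
    unfolding weber_ddx_def D_def [symmetric] by (intro nth_Abs_fls_lower_bound [of "-1"]) simp
  have eq: "fls_X ^ 2 * (weber_ddx s S z + S z ^ 2) =
          fls_const (weber_x s z ^ 2 / 4 - lam) + fls_const (\<nu> / 2) * fls_X"
    using S z unfolding weber_riccati_solution_def by blast
  \<comment> \<open>Shifting the index by one turns the pole in \<open>\<hbar>\<close> into a power series.\<close>
  define F where "F = Abs_fps (\<lambda>k. fls_nth (S z) (int k - 1))"
  have SF: "S z = fls_shift 1 (fps_to_fls F)"
    by (rule fls_eqI) (use low [OF z] in \<open>auto simp: F_def\<close>)
  have "fls_X ^ 2 * S z ^ 2 = fps_to_fls (F * F)"
    unfolding SF
    by (simp add: fls_times_fps_to_fls power2_eq_square fls_X_times_conv_shift fls_shifted_times_simps)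
  then have sq: "fls_nth (fls_X ^ 2 * S z ^ 2) (int (Suc n)) = fps_nth (F * F) (Suc n)"
    by (simp del: of_nat_Suc)
  have "fls_nth (fls_X ^ 2 * weber_ddx s S z) (int (Suc n)) = D (int n - 1)"
    by (simp add: power2_eq_square fls_X_times_conv_shift fls_shifted_times_simps Dnth)
  moreover have "fls_nth (fls_const (weber_x s z ^ 2 / 4 - lam) + fls_const (\<nu> / 2) * fls_X) (int (Suc n))
      = (if n = 0 then \<nu> / 2 else 0)"
    by (simp add: fls_X_def)
  ultimately have 1: "D (int n - 1) + fps_nth (F * F) (Suc n) = (if n = 0 then \<nu> / 2 else 0)"
    using arg_cong [OF eq, of "\<lambda>f. fls_nth f (int (Suc n))"] sq
    by (simp add: distrib_left del: of_nat_Suc)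
  have "fps_nth (F * F) (Suc n) = fps_nth F 0 * fps_nth F (Suc n) + (\<Sum>i=Suc 0..Suc n. fps_nth F i * fps_nth F (Suc n - i))"
    unfolding fps_mult_nth by (subst sum.atLeast_Suc_atMost) auto
  also have "(\<Sum>i=Suc 0..Suc n. fps_nth F i * fps_nth F (Suc n - i)) =
      (\<Sum>i=0..n. fps_nth F (Suc i) * fps_nth F (n - i))"
    by (subst sum.atLeast_Suc_atMost_Suc_shift) simp
  also have "\<dots> = (\<Sum>i<n. fps_nth F (Suc i) * fps_nth F (n - i)) + fps_nth F (Suc n) * fps_nth F 0"
    by (simp add: atLeast0AtMost lessThan_Suc_atMost [symmetric])
  also have "(\<Sum>i<n. fps_nth F (Suc i) * fps_nth F (n - i)) =
     (\<Sum>i<n. fls_nth (S z) (int i) * fls_nth (S z) (int n - 1 - int i))"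
    by (rule sum.cong) (auto simp: F_def of_nat_diff algebra_simps)
  finally show "2 * fls_nth (S z) (-1) * fls_nth (S z) (int n) =
      (if n = 0 then \<nu> / 2 else 0) - deriv (\<lambda>w. fls_nth (S w) (int n - 1)) z / deriv (weber_x s) z
      - (\<Sum>i<n. fls_nth (S z) (int i) * fls_nth (S z) (int n - 1 - int i))"
    using 1 unfolding D_def by (simp add: F_def algebra_simps)
qed

lemma weber_x_deriv_y:
  assumes "z \<in> - {0, 1, -1}"
  shows "1 / deriv (weber_x s) z = (weber_y z + 1) / s"
proof -
  have "z ^ 2 - 1 \<noteq> 0" "z \<noteq> 0" using assms by (auto simp: power2_eq_1_iff)
  then show ?thesis
    by (simp add: deriv_weber_x weber_y_def field_simps)
qed

text \<open>
  Both sides obey the same recursion. The change of variables uses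
  \<open>z^2 y = y + 1\<close>, \<open>dx/dz = s / (y + 1)\<close>, \<open>2 S\<^bsub>-1\<^esub> = s / (z y)\<close> and \<open>dy/dz = - 2 z y^2\<close>.
\<close>

lemma riccati_solution_formula:
  assumes lam: "lam \<noteq> 0" "s ^ 2 = lam" and S: "weber_riccati_solution lam s \<nu> S"
    and z: "z \<in> - {0, 1, -1}"
  shows "fls_nth (S z) (int n) =
    (1 / lam) ^ n / s * (z * weber_y z * poly (poly (weber_c n) [:(\<nu> + 1) / 2:]) (weber_y z))"
  using z
proof (induction n arbitrary: z rule: less_induct)
  case (less n)
  have s: "s \<noteq> 0" using lam by auto
  have op: "open (- {0, 1, -1 :: complex})"
    by (intro open_Compl finite_imp_closed) auto
  have z: "z \<noteq> 0" "z \<noteq> 1" "z \<noteq> -1" using less.prems by auto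
  define c where "c k = poly (weber_c k) [:(\<nu> + 1) / 2:]" for k
  define y where "y = weber_y z"
  note yf = weber_y_facts [OF z(2,3), folded y_def]
  have Sm: "2 * fls_nth (S z) (-1) * (z * y) = s"
  proof -
    have "2 * fls_nth (S z) (-1) * (z * y) = s * (y * (z ^ 2 - 1))"
      unfolding riccati_coefficients(1) [OF S less.prems] using z
      by (simp add: field_simps power2_eq_square)
    then show ?thesis unfolding yf(1) by simp
  qed
  have rec: "fls_nth (S z) (int n) = z * y / s * ((if n = 0 then \<nu> / 2 else 0)
      - deriv (\<lambda>w. fls_nth (S w) (int n - 1)) z * ((y + 1) / s)
      - (\<Sum>i<n. fls_nth (S z) (int i) * fls_nth (S z) (int n - 1 - int i)))"
    (is "_ = z * y / s * ?rhs")
  proof -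
    have "s * fls_nth (S z) (int n) = z * y * (2 * fls_nth (S z) (-1) * fls_nth (S z) (int n))"
      unfolding Sm [symmetric] by (simp add: mult_ac)
    also have "2 * fls_nth (S z) (-1) * fls_nth (S z) (int n) = ?rhs"
      using riccati_coefficients(2) [OF S less.prems, of n] weber_x_deriv_y [OF less.prems, of s]
      by (simp add: y_def divide_inverse)
    finally show ?thesis using s by (simp add: field_simps)
  qed
  show ?case
  proof (cases n)
    case 0
    have "eventually (\<lambda>w. fls_nth (S w) (-1) = s / 2 * (w - 1 / w)) (nhds z)"
      using eventually_nhds_in_open [OF op less.prems]
      by eventually_elim (rule riccati_coefficients(1) [OF S])
    then have "deriv (\<lambda>w. fls_nth (S w) (-1)) z = deriv (\<lambda>w. s / 2 * (w - 1 / w)) z"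
      by (rule deriv_cong_ev) simp
    also have "\<dots> = s / 2 * (1 + 1 / z ^ 2)"
      using z by (intro DERIV_imp_deriv) (auto intro!: derivative_eq_intros simp: field_simps power2_eq_square)
    finally have d: "deriv (\<lambda>w. fls_nth (S w) (-1)) z = s / 2 * (1 + 1 / z ^ 2)" .
    have "deriv (\<lambda>w. fls_nth (S w) (-1)) z * ((y + 1) / s) = (1 + 1 / z ^ 2) * (y + 1) / 2"
      unfolding d using s by simp
    also have "\<dots> = (z ^ 2 * y + y) / 2"
      unfolding yf(2) using z by (simp add: field_simps)
    also have "\<dots> = y + 1 / 2"
      unfolding yf(2) [symmetric] by (simp add: field_simps)
    finally have "deriv (\<lambda>w. fls_nth (S w) (-1)) z * ((y + 1) / s) = y + 1 / 2" .
    then have "fls_nth (S z) 0 = z * y / s * ((\<nu> + 1) / 2 - y - 1)"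
      using rec 0 by (simp add: field_simps)
    then show ?thesis
      using 0 by (simp add: y_def [symmetric] mult_ac)
  next
    case (Suc k)
    have IH: "fls_nth (S w) (int i) = (1 / lam) ^ i / s * (w * weber_y w * poly (c i) (weber_y w))"
      if "i < Suc k" "w \<in> - {0, 1, -1}" for i w
      using less.IH [of i w] that unfolding c_def Suc by simp
    have "eventually (\<lambda>w. fls_nth (S w) (int k) = (1 / lam) ^ k / s * (w * weber_y w * poly (c k) (weber_y w))) (nhds z)"
      using eventually_nhds_in_open [OF op less.prems]
      by eventually_elim (rule IH, simp)
    then have "deriv (\<lambda>w. fls_nth (S w) (int k)) z =
        deriv (\<lambda>w. (1 / lam) ^ k / s * (w * weber_y w * poly (c k) (weber_y w))) z"
      by (rule deriv_cong_ev) simp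
    also have "\<dots> = (1 / lam) ^ k / s * (y * poly (c k) y - 2 * (z ^ 2 * y) * y * (poly (c k) y + y * poly (pderiv (c k)) y))"
    proof (intro DERIV_imp_deriv DERIV_cmult)
      show "((\<lambda>w. w * weber_y w * poly (c k) (weber_y w)) has_field_derivative
        y * poly (c k) y - 2 * (z ^ 2 * y) * y * (poly (c k) y + y * poly (pderiv (c k)) y)) (at z)"
        by (auto intro!: derivative_eq_intros weber_y_deriv poly_weber_y_deriv z
          simp: y_def [symmetric] power2_eq_square algebra_simps)
    qed
    finally have d: "deriv (\<lambda>w. fls_nth (S w) (int k)) z = 
        (1 / lam) ^ k / s * (y * poly (c k) y - 2 * (y + 1) * y * (poly (c k) y + y * poly (pderiv (c k)) y))"
      unfolding yf(2) .
    have "(\<Sum>i<Suc k. fls_nth (S z) (int i) * fls_nth (S z) (int k - int i)) =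
        (\<Sum>i<Suc k. (1 / lam) ^ k / s ^ 2 * (y * (y + 1)) * (poly (c i) y * poly (c (k - i)) y))"
    proof (rule sum.cong)
      fix i assume "i \<in> {..<Suc k}"
      then have i: "i \<le> k" by simp
      then have ki: "int k - int i = int (k - i)" by simp
      have pw: "(1 / lam) ^ k = (1 / lam) ^ i * (1 / lam) ^ (k - i)"
        using i by (simp flip: power_add)
      have "fls_nth (S z) (int i) = (1 / lam) ^ i / s * (z * y * poly (c i) y)"
        "fls_nth (S z) (int (k - i)) = (1 / lam) ^ (k - i) / s * (z * y * poly (c (k - i)) y)"
        unfolding y_def using i less.prems by (simp_all only: IH less_Suc_eq_le diff_le_self)
      then show "fls_nth (S z) (int i) * fls_nth (S z) (int k - int i) =
          (1 / lam) ^ k / s ^ 2 * (y * (y + 1)) * (poly (c i) y * poly (c (k - i)) y)"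
        unfolding yf(2) ki pw by (simp add: power2_eq_square mult_ac)
    qed simp
    also have "\<dots> = (1 / lam) ^ k / s ^ 2 * (y * (y + 1)) * (\<Sum>i\<le>k. poly (c i) y * poly (c (k - i)) y)"
      by (simp add: sum_distrib_left lessThan_Suc_atMost)
    finally have sm: "(\<Sum>i<Suc k. fls_nth (S z) (int i) * fls_nth (S z) (int k - int i)) = \<dots>" .
    have cS: "poly (c (Suc k)) y = - (y * (y + 1)) * ((\<Sum>i\<le>k. poly (c i) y * poly (c (k - i)) y)
        - (2 * y + 1) * poly (c k) y - 2 * (y * (y + 1)) * poly (pderiv (c k)) y)"
      unfolding c_def poly_weber_c_Suc by (simp add: poly_sum del: poly_pCons)
    have "fls_nth (S z) (int n) = z * y / s * (- ((1 / lam) ^ k / s * (y * poly (c k) y - 2 * (y + 1) * y *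
        (poly (c k) y + y * poly (pderiv (c k)) y))) * ((y + 1) / s)
        - (1 / lam) ^ k / s ^ 2 * (y * (y + 1)) * (\<Sum>i\<le>k. poly (c i) y * poly (c (k - i)) y))"
      unfolding rec using Suc d sm by simp
    also have "\<dots> = z * y / s * ((1 / lam) ^ k * (1 / s ^ 2) * poly (c (Suc k)) y)"
      unfolding cS by (simp add: divide_inverse power2_eq_square algebra_simps)
    also have "1 / s ^ 2 = 1 / lam" by (simp add: lam)
    finally show ?thesis unfolding Suc c_def y_def by (simp add: mult_ac)
  qed
qed

text \<open>
  The right-hand side is \<open>\<lambda>\<^bsup>-m\<^esup> r\<^sub>m (dy/dz)\<close> with \<open>m = n + 1\<close>. The zeros of \<open>c\<^sub>m\<close> at \<open>y = 0\<close> and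
  \<open>y = -1\<close> are exactly what makes the differential regular at \<open>z = \<infinity>\<close> and \<open>z = 0\<close>.
\<close>

lemma weber_integrand:
  assumes lam: "lam \<noteq> 0" "s ^ 2 = lam" and S: "weber_riccati_solution lam s \<nu> S"
    and z: "z \<in> - {0, 1, -1}"
  shows "fls_nth (S z) (int (Suc n)) * deriv (weber_x s) z =
    (1 / lam) ^ Suc n * (poly (poly (weber_r n) [:(\<nu> + 1) / 2:]) (weber_y z) * (- 2 * z * weber_y z ^ 2))"
proof -
  have s: "s \<noteq> 0" using lam by auto
  have z': "z \<noteq> 0" "z \<noteq> 1" "z \<noteq> -1" using z by auto
  define y where "y = weber_y z"
  define r where "r = poly (poly (weber_r n) [:(\<nu> + 1) / 2:]) y"
  note yf = weber_y_facts [OF z'(2,3), folded y_def]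
  have dx: "deriv (weber_x s) z * (y + 1) = s"
    using weber_x_deriv_y [OF z, of s] s deriv_weber_x_nz [OF s, of z] z by (simp add: y_def field_simps)
  have "fls_nth (S z) (int (Suc n)) = (1 / lam) ^ Suc n / s * (z * y * (- 2 * (y * (y + 1)) * r))"
    unfolding riccati_solution_formula [OF lam S z] poly_weber_c_Suc_r y_def r_def
    by (simp del: poly_pCons)
  then have "fls_nth (S z) (int (Suc n)) * deriv (weber_x s) z =
      (1 / lam) ^ Suc n / s * (- 2 * z * y ^ 2 * r) * (deriv (weber_x s) z * (y + 1))"
    by (simp add: power2_eq_square)
  also have "\<dots> = (1 / lam) ^ Suc n * (r * (- 2 * z * y ^ 2))"
    unfolding dx using s by simp
  finally show ?thesis unfolding y_def r_def .
qed

section \<open>The integral along the path\<close>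

lemma integral_zero_to_infinity_primitive:
  assumes \<gamma>: "path_zero_to_infinity \<gamma>"
    and F: "\<And>z. z \<notin> {1, -1} \<Longrightarrow> (F has_field_derivative f z) (at z)"
    and lim: "(F \<longlongrightarrow> L) at_infinity"
  shows "integral_zero_to_infinity \<gamma> f = L - F 0"
proof -
  have "contour_integral (subpath 0 u \<gamma>) f = F (\<gamma> u) - F 0" if u: "u \<in> {0<..<1}" for u
  proof -
    have "path_image (subpath 0 u \<gamma>) \<subseteq> - {1, -1}"
      using \<gamma> u unfolding path_zero_to_infinity_def by (auto simp: path_image_subpath)
    moreover have "valid_path (subpath 0 u \<gamma>)"
      using \<gamma> u unfolding path_zero_to_infinity_def by blast
    ultimately have "(f has_contour_integral (F (pathfinish (subpath 0 u \<gamma>)) - F (pathstart (subpath 0 u \<gamma>)))) (subpath 0 u \<gamma>)"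
      using F by (intro contour_integral_primitive [of "- {1, -1}"]) (auto intro: has_field_derivative_at_within)
    then show ?thesis
      using \<gamma> by (auto dest!: contour_integral_unique simp: path_zero_to_infinity_def)
  qed
  then have ev: "eventually (\<lambda>u. F (\<gamma> u) - F 0 = contour_integral (subpath 0 u \<gamma>) f) (at_left (1::real))"
    using eventually_at_left_real [of 0 "1::real"] by (auto elim: eventually_mono)
  have "((\<lambda>u. F (\<gamma> u) - F 0) \<longlongrightarrow> L - F 0) (at_left 1)"
    using \<gamma> unfolding path_zero_to_infinity_def
    by (intro tendsto_intros filterlim_compose [OF lim]) auto
  then have "((\<lambda>u. contour_integral (subpath 0 u \<gamma>) f) \<longlongrightarrow> L - F 0) (at_left 1)"
    using ev by (rule Lim_transform_eventually)
  then show ?thesis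
    unfolding integral_zero_to_infinity_def by (intro tendsto_Lim) (auto simp: trivial_limit_at_left_real)
qed

lemma weber_y_at_infinity: "(weber_y \<longlongrightarrow> 0) at_infinity"
proof -
  have "filterlim (\<lambda>z::complex. z ^ 2 - 1) at_infinity at_infinity"
    unfolding diff_conv_add_uminus add.commute [of _ "- 1"]
    by (intro tendsto_add_filterlim_at_infinity [OF tendsto_const] filterlim_power_at_infinity filterlim_ident) auto
  then show ?thesis
    unfolding weber_y_def [abs_def] divide_inverse
    by (auto intro: tendsto_inverse_0 filterlim_compose)
qed

text \<open>
  A primitive in \<open>y\<close> pulls back to a primitive in \<open>z\<close> that is regular at \<open>z = 0\<close>, where \<open>y = -1\<close>, and
  tends at \<open>z = \<infinity>\<close> to its value at \<open>y = 0\<close>. Its derivative agrees with the integrand for \<open>z \<noteq> 0\<close> and,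
  being continuous, supplies the removed value at \<open>z = 0\<close>.
\<close>

lemma weber_voros_coefficient:
  assumes lam: "lam \<noteq> 0" "s ^ 2 = lam" and S: "weber_riccati_solution lam s \<nu> S"
    and \<gamma>: "path_zero_to_infinity \<gamma>"
  shows "integral_zero_to_infinity \<gamma>
         (remove_sings (\<lambda>z. fls_nth (S z) (int (Suc n)) * deriv (weber_x s) z)) =
       (1 / lam) ^ Suc n * poly (weber_v n) ((\<nu> + 1) / 2)"
proof -
  define r where "r = poly (weber_r n) [:(\<nu> + 1) / 2:]"
  define F where "F z = (1 / lam) ^ Suc n * poly (poly_primitive r) (weber_y z)" for z
  define f where "f z = (1 / lam) ^ Suc n * (poly r (weber_y z) * (- 2 * z * weber_y z ^ 2))" for z
  have F: "(F has_field_derivative f z) (at z)" if "z \<notin> {1, -1}" for z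
    using poly_weber_y_deriv [of z "poly_primitive r" UNIV] that unfolding F_def f_def
    by (intro DERIV_cmult) auto
  have "remove_sings (\<lambda>z. fls_nth (S z) (int (Suc n)) * deriv (weber_x s) z) z = f z" if "z \<notin> {1, -1}" for z
  proof (rule remove_sings_eqI)
    have "isCont (weber_y) z" using weber_y_deriv [of z UNIV] that by (auto intro: DERIV_isCont)
    then have "isCont f z" unfolding f_def by (intro continuous_intros)
    then have "f \<midarrow>z\<rightarrow> f z" by (rule isContD)
    moreover have "eventually (\<lambda>z. f z = fls_nth (S z) (int (Suc n)) * deriv (weber_x s) z) (at z)"
    proof -
      have "eventually (\<lambda>w. w \<in> - ({0, 1, -1} - {z})) (at z)"
        by (intro eventually_at_in_open' open_Compl finite_imp_closed) auto
      moreover have "eventually (\<lambda>w. w \<noteq> z) (at z)" by (simp add: eventually_at_filter)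
      ultimately show ?thesis
      proof eventually_elim
        case (elim w)
        then have w: "w \<in> - {0, 1, -1}" by auto
        show ?case
          unfolding weber_integrand [OF lam S w] f_def r_def ..
      qed
    qed
    ultimately show "(\<lambda>z. fls_nth (S z) (int (Suc n)) * deriv (weber_x s) z) \<midarrow>z\<rightarrow> f z"
      by (rule Lim_transform_eventually)
  qed
  then have "(F has_field_derivative remove_sings (\<lambda>z. fls_nth (S z) (int (Suc n)) * deriv (weber_x s) z) z) (at z)"
    if "z \<notin> {1, -1}" for z
    using F that by simp
  moreover have "(F \<longlongrightarrow> (1 / lam) ^ Suc n * poly (poly_primitive r) 0) at_infinity"
    unfolding F_def by (intro tendsto_intros weber_y_at_infinity)
  ultimately have "integral_zero_to_infinity \<gamma> (remove_sings (\<lambda>z. fls_nth (S z) (int (Suc n)) * deriv (weber_x s) z))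
     = (1 / lam) ^ Suc n * poly (poly_primitive r) 0 - F 0"
    by (rule integral_zero_to_infinity_primitive [OF \<gamma>])
  also have "\<dots> = (1 / lam) ^ Suc n * integral_m1_0 r"
    by (simp add: F_def weber_y_def integral_m1_0_def right_diff_distrib)
  finally show ?thesis by (simp only: r_def poly_weber_v)
qed

theorem theorem4p10:
  fixes lam \<nu> s :: complex and S :: "complex \<Rightarrow> complex fls" and \<gamma> :: "real \<Rightarrow> complex"
  assumes "lam \<noteq> 0"
    and "s ^ 2 = lam"
    and "weber_riccati_solution lam s \<nu> S"
    and "path_zero_to_infinity \<gamma>"
  shows "weber_voros s \<gamma> S =
    Abs_fps (\<lambda>m. if m = 0 then 0 else
      bernoulli_polynomial (m + 1) ((\<nu> + 1) / 2) / (of_nat m * of_nat (m + 1)) * (1 / lam) ^ m)"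
proof (rule fps_ext)
  fix m
  show "fps_nth (weber_voros s \<gamma> S) m = fps_nth (Abs_fps (\<lambda>m. if m = 0 then 0 else
      bernoulli_polynomial (m + 1) ((\<nu> + 1) / 2) / (of_nat m * of_nat (m + 1)) * (1 / lam) ^ m)) m"
  proof (cases m)
    case 0
    then show ?thesis by (simp add: weber_voros_def)
  next
    case (Suc n)
    then show ?thesis
      by (simp add: weber_voros_def weber_voros_coefficient [OF assms] weber_v_eq_bernoulli
        del: of_nat_Suc power_Suc)
  qed
qed

end
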